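(* Let $M$ be a two-counter machine and let $s\in\mathcal{S}\Sigma_M$ be a configuration with $s\le T_M$. Suppose that the inclusion of languages $$l\big(s_rR_M^*\big)\subseteq l\big(\Sigma_M^*(C_M+c_1)_r+\Sigma_M^*\Sigma_M^{\neq}\ddot\Sigma_M^*\big)$$ holds in $\mathcal{L}\ddot\Sigma_M$. If $s\to_{R_M}^* c_x$ for some $x\in\{0,1\}$, then $x=1$.
   Context: Pre-Kleene algebra: constants $0,1$, operations $+,\cdot,{}^*$ with $(+,0)$ a commutative idempotent monoid, $(\cdot,1)$ a monoid, two-sided distributivity, $0$ absorbing, and $x^*=1+xx^*$; order $x\le y$ iff $x+y=y$. A commutable set is a set with a reflexive symmetric relation $\sim$ (discrete if $\sim$ is equality). $\mathcal{S}Y$: strings over $Y$ modulo $xy=yx$ for $x\sim y$. $\mathcal{T}Y$: free pre-Kleene algebra on $Y$ subject to $xy=yx$ for $x\sim y$. $\mathcal{L}Y$: smallest subalgebra of the power set of $\mathcal{S}Y$ (operations $\emptyset,\{1\},\cup$, concatenation, $A^*=\bigcup_nA^n$) containing singletons; $l:\mathcal{T}Y\to\mathcal{L}Y$ the morphism with $l(y)=\{y\}$. For strings $s$ and terms $e$, $s\le e$ is the order in $\mathcal{T}Y$. A finite set of elements is identified with their sum. $\ddot Y$ is the set $\{y_l\}\cup\{y_r\}$ ($y\in Y$) with $y_l\sim y'_r$ always, $y_l\sim y'_l$ iff $y\sim y'$, $y_r\sim y'_r$ iff $y\sim y'$. The morphisms $(-)_l,(-)_r:\mathcal{T}Y\to\mathcal{T}\ddot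 Y$ send $y$ to $y_l$, resp. $y_r$; a term or string $e$ over $Y$ written without subscript is regarded in $\mathcal{T}\ddot Y$ via $y\mapsto y_ly_r$. For strings $s,s'$ over $Y$ and $e\in\mathcal{T}\ddot Y$, $s\to_e s'$ means $s_ls'_r\le e$; $\to_e^*$ is its reflexive transitive closure. A two-counter machine $M=(Q_M,\dot q,\iota)$ has a finite set of states $Q_M$, initial state $\dot q$, and $\iota:Q_M\to I_M$ where instructions are $\mathrm{Inc}(r,q)$, $\mathrm{If}(r,q,q')$ ($r\in\{1,2\}$, $q,q'\in Q_M$) and $\mathrm{Halt}(x)$ ($x\in\{0,1\}$). $\Sigma_M=Q_M\uplus\{a,b,c_0,c_1\}$ is discrete; $C_M=a^*b^*Q_M\in\mathcal{T}\Sigma_M$ and $T_M=C_M+c_0+c_1$. In $\mathcal{T}\ddot\Sigma_M$: $[\![\mathrm{Inc}(1,q)]\!]=a_r(a_la_r)^*(b_lb_r)^*q_r$, $[\![\mathrm{Inc}(2,q)]\!]=(a_la_r)^*b_r(b_lb_r)^*q_r$, $[\![\mathrm{If}(1,q_1,q_2)]\!]=(b_lb_r)^*(q_1)_r+a_l(a_la_r)^*(b_lb_r)^*(q_2)_r$, $[\![\mathrm{If}(2,q_1,q_2)]\!]=(a_la_r)^*(q_1)_r+(a_la_r)^*b_l(b_lb_r)^*(q_2)_r$, $[\![\mathrm{Halt}(x)]\!]=(c_x)_r$, and $R_M=\sum_{q\in Q_M}[\![\iota(q)]\!]q_l$. Also $\Sigma_M^*=(\sum_{x\in\Sigma_M}x_lx_r)^*$,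 $\ddot\Sigma_M^*=(\sum_{y\in\ddot\Sigma_M}y)^*$, and $\Sigma_M^{\neq}=\sum_{x,y\in\Sigma_M,x\neq y}x_ly_r$. *)

theory Defs
  imports Main "HOL-Library.Z2"
begin

section \<open>Pre-Kleene algebras\<close>

text \<open>Built on \<^class>\<open>semiring_0\<close> rather than \<^class>\<open>semiring_1\<close>, since the latter would
  exclude the trivial algebra by demanding \<open>0 \<noteq> 1\<close>.\<close>

class pre_kleene_algebra = semiring_0 + monoid_mult + ord +
  fixes star :: "'a \<Rightarrow> 'a" (\<open>(_\<^sup>\<star>)\<close> [1000] 999)
  assumes add_idem: "x + x = x"
    and star_unfold: "x\<^sup>\<star> = 1 + x * x\<^sup>\<star>"
    and less_eq_iff_add: "x \<le> y \<longleftrightarrow> x + y = y"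
    and less_iff_le_neq: "x < y \<longleftrightarrow> x \<le> y \<and> x \<noteq> y"
begin

subclass order
proof
  fix x y z
  show "x < y \<longleftrightarrow> x \<le> y \<and> \<not> y \<le> x"
    by (metis add.commute less_eq_iff_add less_iff_le_neq)
  show "x \<le> x" by (simp add: less_eq_iff_add add_idem)
  show "x \<le> z" if "x \<le> y" "y \<le> z" using that by (metis less_eq_iff_add add.assoc)
  show "x = y" if "x \<le> y" "y \<le> x" using that by (metis less_eq_iff_add add.commute)
qed

end

definition pka_morphism :: "('a::pre_kleene_algebra \<Rightarrow> 'b::pre_kleene_algebra) \<Rightarrow> bool" where
  "pka_morphism h \<longleftrightarrow> h 0 = 0 \<and> h 1 = 1 \<and> (\<forall>x y. h (x + y) = h x + h y) \<and>
     (\<forall>x y. h (x * y) = h x * h y) \<and> (\<forall>x. h (x\<^sup>\<star>) = (h x)\<^sup>\<star>)"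


section \<open>Commutable sets and strings\<close>

class commutable =
  fixes commutes :: "'a \<Rightarrow> 'a \<Rightarrow> bool" (infix \<open>\<sim>\<close> 50)
  assumes commutes_refl: "x \<sim> x"
    and commutes_sym: "x \<sim> y \<Longrightarrow> y \<sim> x"

inductive str_eq :: "'y::commutable list \<Rightarrow> 'y list \<Rightarrow> bool" where
  str_eq_swap: "x \<sim> y \<Longrightarrow> str_eq [x, y] [y, x]"
| str_eq_refl: "str_eq u u"
| str_eq_sym: "str_eq u v \<Longrightarrow> str_eq v u"
| str_eq_trans: "str_eq u v \<Longrightarrow> str_eq v w \<Longrightarrow> str_eq u w"
| str_eq_append: "str_eq u u' \<Longrightarrow> str_eq v v' \<Longrightarrow> str_eq (u @ v) (u' @ v')"

text \<open>The type \<open>'y str\<close> is \<open>\<S>Y\<close>.\<close>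

quotient_type (overloaded) 'y str = "'y::commutable list" / str_eq
  by (intro equivpI reflpI sympI transpI) (blast intro: str_eq.intros)+

instantiation str :: (commutable) monoid_mult
begin

lift_definition one_str :: "'a str" is "[]" .

lift_definition times_str :: "'a str \<Rightarrow> 'a str \<Rightarrow> 'a str" is "(@)"
  by (rule str_eq_append)

instance
  by standard (transfer, simp add: str_eq_refl)+

end

lift_definition letter :: "'y::commutable \<Rightarrow> 'y str" is "\<lambda>y. [y]" .

lemma letter_commute:
  fixes x y :: "'y::commutable"
  assumes "x \<sim> y"
  shows "letter x * letter y = letter y * letter x"
  using assms by transfer (simp add: str_eq_swap)


section \<open>The free pre-Kleene algebra on a commutable set\<close>

datatype 'y pka_exp =
    Zero
  | One
  | Var 'y
  | Plus "'y pka_exp" "'y pka_exp"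
  | Times "'y pka_exp" "'y pka_exp"
  | Star "'y pka_exp"

inductive pka_eq :: "'y::commutable pka_exp \<Rightarrow> 'y pka_exp \<Rightarrow> bool" where
  pka_eq_refl: "pka_eq e e"
| pka_eq_sym: "pka_eq e f \<Longrightarrow> pka_eq f e"
| pka_eq_trans: "pka_eq e f \<Longrightarrow> pka_eq f g \<Longrightarrow> pka_eq e g"
| pka_eq_cong_Plus: "pka_eq e e' \<Longrightarrow> pka_eq f f' \<Longrightarrow> pka_eq (Plus e f) (Plus e' f')"
| pka_eq_cong_Times: "pka_eq e e' \<Longrightarrow> pka_eq f f' \<Longrightarrow> pka_eq (Times e f) (Times e' f')"
| pka_eq_cong_Star: "pka_eq e e' \<Longrightarrow> pka_eq (Star e) (Star e')"
| pka_eq_Plus_assoc: "pka_eq (Plus (Plus e f) g) (Plus e (Plus f g))"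
| pka_eq_Plus_comm: "pka_eq (Plus e f) (Plus f e)"
| pka_eq_Plus_Zero: "pka_eq (Plus Zero e) e"
| pka_eq_Plus_idem: "pka_eq (Plus e e) e"
| pka_eq_Times_assoc: "pka_eq (Times (Times e f) g) (Times e (Times f g))"
| pka_eq_One_Times: "pka_eq (Times One e) e"
| pka_eq_Times_One: "pka_eq (Times e One) e"
| pka_eq_distrib_right: "pka_eq (Times (Plus e f) g) (Plus (Times e g) (Times f g))"
| pka_eq_distrib_left: "pka_eq (Times e (Plus f g)) (Plus (Times e f) (Times e g))"
| pka_eq_Zero_Times: "pka_eq (Times Zero e) Zero"
| pka_eq_Times_Zero: "pka_eq (Times e Zero) Zero"
| pka_eq_Star_unfold: "pka_eq (Star e) (Plus One (Times e (Star e)))"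
| pka_eq_Var_comm: "x \<sim> y \<Longrightarrow> pka_eq (Times (Var x) (Var y)) (Times (Var y) (Var x))"

text \<open>The type \<open>'y trm\<close> is \<open>\<T>Y\<close>.\<close>

quotient_type (overloaded) 'y trm = "'y::commutable pka_exp" / pka_eq
  by (intro equivpI reflpI sympI transpI) (blast intro: pka_eq.intros)+

instantiation trm :: (commutable) pre_kleene_algebra
begin

lift_definition zero_trm :: "'a trm" is Zero .
lift_definition one_trm :: "'a trm" is One .
lift_definition plus_trm :: "'a trm \<Rightarrow> 'a trm \<Rightarrow> 'a trm" is Plus
  by (rule pka_eq_cong_Plus)
lift_definition times_trm :: "'a trm \<Rightarrow> 'a trm \<Rightarrow> 'a trm" is Times
  by (rule pka_eq_cong_Times)
lift_definition star_trm :: "'a trm \<Rightarrow> 'a trm" is Star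
  by (rule pka_eq_cong_Star)
definition less_eq_trm :: "'a trm \<Rightarrow> 'a trm \<Rightarrow> bool" where
  "x \<le> y \<longleftrightarrow> x + y = y" for x y :: "'a trm"
definition less_trm :: "'a trm \<Rightarrow> 'a trm \<Rightarrow> bool" where
  "x < y \<longleftrightarrow> x \<le> y \<and> x \<noteq> y" for x y :: "'a trm"

instance
proof
  fix a b c :: "'a trm"
  show "a + b + c = a + (b + c)" by transfer (rule pka_eq.intros)
  show "a + b = b + a" by transfer (rule pka_eq.intros)
  show "0 + a = a" by transfer (rule pka_eq.intros)
  show "a * b * c = a * (b * c)" by transfer (rule pka_eq.intros)
  show "(a + b) * c = a * c + b * c" by transfer (rule pka_eq.intros)
  show "a * (b + c) = a * b + a * c" by transfer (rule pka_eq.intros)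
  show "0 * a = 0" by transfer (rule pka_eq.intros)
  show "a * 0 = 0" by transfer (rule pka_eq.intros)
  show "1 * a = a" by transfer (rule pka_eq.intros)
  show "a * 1 = a" by transfer (rule pka_eq.intros)
  show "a + a = a" by transfer (rule pka_eq.intros)
  show "a\<^sup>\<star> = 1 + a * a\<^sup>\<star>" by transfer (rule pka_eq.intros)
qed (simp_all add: less_eq_trm_def less_trm_def)

end

lift_definition var :: "'y::commutable \<Rightarrow> 'y trm" is Var .

primrec eval_exp :: "('y \<Rightarrow> 'a::pre_kleene_algebra) \<Rightarrow> 'y pka_exp \<Rightarrow> 'a" where
  "eval_exp f Zero = 0"
| "eval_exp f One = 1"
| "eval_exp f (Var y) = f y"
| "eval_exp f (Plus d e) = eval_exp f d + eval_exp f e"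
| "eval_exp f (Times d e) = eval_exp f d * eval_exp f e"
| "eval_exp f (Star e) = (eval_exp f e)\<^sup>\<star>"

text \<open>\<open>ext f\<close> is the morphism sending each generator \<open>y\<close> to \<open>f y\<close>. It is independent of the
  chosen representatives only if \<open>f\<close> maps commuting generators to commuting elements; the lemmas
  below establish the universal property of \<open>'y trm\<close> under this assumption.\<close>

definition ext :: "('y::commutable \<Rightarrow> 'a::pre_kleene_algebra) \<Rightarrow> 'y trm \<Rightarrow> 'a" where
  "ext f t = eval_exp f (rep_trm t)"

definition respects_comm :: "('y::commutable \<Rightarrow> 'a::pre_kleene_algebra) \<Rightarrow> bool" where
  "respects_comm f \<longleftrightarrow> (\<forall>x y. x \<sim> y \<longrightarrow> f x * f y = f y * f x)"

lemma eval_exp_pka_eq: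
  assumes "pka_eq d e" and "respects_comm f"
  shows "eval_exp f d = eval_exp f e"
  using assms(1)
proof induction
  case (pka_eq_Star_unfold e)
  show ?case unfolding eval_exp.simps by (rule star_unfold)
next
  case (pka_eq_Var_comm x y)
  then show ?case using assms(2) unfolding respects_comm_def eval_exp.simps by blast
qed (simp_all add: add_idem ac_simps distrib_left distrib_right)

lemma ext_abs:
  assumes "respects_comm f"
  shows "ext f (abs_trm e) = eval_exp f e"
  unfolding ext_def
  by (rule eval_exp_pka_eq[OF _ assms])
    (metis Quotient_trm Quotient_rep_abs pka_eq_refl)

lemma ext_var:
  assumes "respects_comm f"
  shows "ext f (var y) = f y"
  by (simp add: var_def ext_abs[OF assms])

lemma ext_morphism:
  assumes "respects_comm f"
  shows "pka_morphism (ext f)"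
proof -
  note e = ext_abs[OF assms]
  have "ext f 0 = 0" "ext f 1 = 1"
    by (simp_all add: zero_trm_def one_trm_def e)
  moreover have "ext f (x + y) = ext f x + ext f y" for x y
    by (induction x; induction y) (simp add: plus_trm.abs_eq e)
  moreover have "ext f (x * y) = ext f x * ext f y" for x y
    by (induction x; induction y) (simp add: times_trm.abs_eq e)
  moreover have "ext f (x\<^sup>\<star>) = (ext f x)\<^sup>\<star>" for x
    by (induction x) (simp add: star_trm.abs_eq e)
  ultimately show ?thesis by (simp add: pka_morphism_def)
qed

lemma ext_unique:
  assumes "pka_morphism h"
  shows "h = ext (\<lambda>y. h (var y))"
proof -
  let ?f = "\<lambda>y. h (var y)"
  have *: "h (abs_trm e) = eval_exp ?f e" for e
  proof (induction e)
    case Zero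
    then show ?case using assms by (simp add: pka_morphism_def flip: zero_trm_def)
  next
    case One
    then show ?case using assms by (simp add: pka_morphism_def flip: one_trm_def)
  next
    case (Var x)
    then show ?case by (simp add: var.abs_eq)
  next
    case (Plus d e)
    then show ?case using assms by (simp add: pka_morphism_def flip: plus_trm.abs_eq)
  next
    case (Times d e)
    then show ?case using assms by (simp add: pka_morphism_def flip: times_trm.abs_eq)
  next
    case (Star e)
    then show ?case using assms by (simp add: pka_morphism_def flip: star_trm.abs_eq)
  qed
  show ?thesis
    unfolding ext_def fun_eq_iff using * by (metis Quotient_trm Quotient_abs_rep)
qed

lemma var_commute:
  fixes x y :: "'y::commutable"
  assumes "x \<sim> y"
  shows "var x * var y = var y * var x"
  using assms by transfer (rule pka_eq_Var_comm)

lift_definition trm_of_str :: "'y::commutable str \<Rightarrow> 'y trm"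
  is "\<lambda>u. prod_list (map var u)"
  subgoal for u v
  proof (induction u v rule: str_eq.induct)
    case (str_eq_swap x y)
    then show ?case using var_commute[OF str_eq_swap] by simp
  qed simp_all
  done

lemma trm_of_str_simps:
  "trm_of_str 1 = 1" "trm_of_str (u * v) = trm_of_str u * trm_of_str v"
  "trm_of_str (letter y) = var y"
proof -
  show "trm_of_str 1 = 1" by (simp add: one_str_def trm_of_str.abs_eq)
  show "trm_of_str (u * v) = trm_of_str u * trm_of_str v"
    by (induction u; induction v) (simp add: times_str.abs_eq trm_of_str.abs_eq)
  show "trm_of_str (letter y) = var y" by (simp add: letter_def trm_of_str.abs_eq)
qed


section \<open>Languages\<close>

definition conc :: "'y::commutable str set \<Rightarrow> 'y str set \<Rightarrow> 'y str set" where
  "conc A B = {u * v | u v. u \<in> A \<and> v \<in> B}"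

primrec lpow :: "'y::commutable str set \<Rightarrow> nat \<Rightarrow> 'y str set" where
  "lpow A 0 = {1}"
| "lpow A (Suc n) = conc A (lpow A n)"

definition lstar :: "'y::commutable str set \<Rightarrow> 'y str set" where
  "lstar A = (\<Union>n. lpow A n)"

inductive_set regular :: "'y::commutable str set set" where
  regular_empty: "{} \<in> regular"
| regular_one: "{1} \<in> regular"
| regular_letter: "{letter y} \<in> regular"
| regular_union: "A \<in> regular \<Longrightarrow> B \<in> regular \<Longrightarrow> A \<union> B \<in> regular"
| regular_conc: "A \<in> regular \<Longrightarrow> B \<in> regular \<Longrightarrow> conc A B \<in> regular"
| regular_lstar: "A \<in> regular \<Longrightarrow> lstar A \<in> regular"

text \<open>The type \<open>'y lang\<close> is \<open>\<L>Y\<close>.\<close>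

typedef (overloaded) 'y lang = "regular :: 'y::commutable str set set"
  by (blast intro: regular_empty)

setup_lifting type_definition_lang

lemma conc_assoc: "conc (conc A B) C = conc A (conc B C)"
  unfolding conc_def by (auto; metis mult.assoc)

lemma lstar_unfold: "lstar A = {1} \<union> conc A (lstar A)"
proof -
  have "lstar A = lpow A 0 \<union> (\<Union>n. lpow A (Suc n))"
    unfolding lstar_def by (auto simp del: lpow.simps) (metis not0_implies_Suc)
  also have "(\<Union>n. lpow A (Suc n)) = conc A (lstar A)"
    by (auto simp: lstar_def conc_def)
  finally show ?thesis by simp
qed

instantiation lang :: (commutable) pre_kleene_algebra
begin

lift_definition zero_lang :: "'a lang" is "{}" by (rule regular_empty)
lift_definition one_lang :: "'a lang" is "{1}" by (rule regular_one)
lift_definition plus_lang :: "'a lang \<Rightarrow> 'a lang \<Rightarrow> 'a lang" is "(\<union>)"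
  by (rule regular_union)
lift_definition times_lang :: "'a lang \<Rightarrow> 'a lang \<Rightarrow> 'a lang" is conc
  by (rule regular_conc)
lift_definition star_lang :: "'a lang \<Rightarrow> 'a lang" is lstar
  by (rule regular_lstar)
lift_definition less_eq_lang :: "'a lang \<Rightarrow> 'a lang \<Rightarrow> bool" is "(\<subseteq>)" .
lift_definition less_lang :: "'a lang \<Rightarrow> 'a lang \<Rightarrow> bool" is "(\<subset>)" .

instance
proof
  fix a b c :: "'a lang"
  show "a + b + c = a + (b + c)" by transfer auto
  show "a + b = b + a" by transfer auto
  show "0 + a = a" by transfer auto
  show "a * b * c = a * (b * c)" by transfer (rule conc_assoc)
  show "(a + b) * c = a * c + b * c" by transfer (auto simp: conc_def)
  show "a * (b + c) = a * b + a * c" by transfer (auto simp: conc_def)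
  show "0 * a = 0" by transfer (auto simp: conc_def)
  show "a * 0 = 0" by transfer (auto simp: conc_def)
  show "1 * a = a" by transfer (auto simp: conc_def)
  show "a * 1 = a" by transfer (auto simp: conc_def)
  show "a + a = a" by transfer auto
  show "a\<^sup>\<star> = 1 + a * a\<^sup>\<star>" by transfer (rule lstar_unfold)
  show "a \<le> b \<longleftrightarrow> a + b = b" by transfer auto
  show "a < b \<longleftrightarrow> a \<le> b \<and> a \<noteq> b" by transfer auto
qed

end

lift_definition lang_letter :: "'y::commutable \<Rightarrow> 'y lang" is "\<lambda>y. {letter y}"
  by (rule regular_letter)

definition lang_of :: "'y::commutable trm \<Rightarrow> 'y lang" where
  "lang_of = ext lang_letter"

lemma respects_comm_lang_letter: "respects_comm lang_letter"
  unfolding respects_comm_def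
  by (intro allI impI, transfer) (auto simp: conc_def letter_commute)


section \<open>The doubled alphabet\<close>

datatype 'y dbl = L 'y | R 'y

instantiation dbl :: (commutable) commutable
begin

fun commutes_dbl :: "'a dbl \<Rightarrow> 'a dbl \<Rightarrow> bool" where
  "commutes_dbl (L x) (L y) = (x \<sim> y)"
| "commutes_dbl (R x) (R y) = (x \<sim> y)"
| "commutes_dbl (L x) (R y) = True"
| "commutes_dbl (R x) (L y) = True"

instance
proof
  fix x y :: "'a dbl"
  show "x \<sim> x" by (cases x) (auto simp: commutes_refl)
  show "y \<sim> x" if "x \<sim> y" using that by (cases x; cases y) (auto simp: commutes_sym)
qed

end

instance dbl :: (finite) finite
proof
  have "x \<in> range L \<union> range R" for x :: "'a dbl"
    by (cases x) simp_all
  then have "(UNIV :: 'a dbl set) = range L \<union> range R"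
    by (intro UNIV_eq_I)
  then show "finite (UNIV :: 'a dbl set)"
    by (rule ssubst) (intro finite_UnI finite_imageI finite_insert[THEN iffD2] finite.emptyI finite)
qed

definition left :: "'y::commutable trm \<Rightarrow> 'y dbl trm" where
  "left = ext (\<lambda>y. var (L y))"

definition right :: "'y::commutable trm \<Rightarrow> 'y dbl trm" where
  "right = ext (\<lambda>y. var (R y))"

lemma respects_comm_var_dbl:
  "respects_comm (\<lambda>y::'y::commutable. var (L y))"
  "respects_comm (\<lambda>y::'y::commutable. var (R y))"
  unfolding respects_comm_def by (auto intro: var_commute)

definition rewrites_to :: "'y::commutable dbl trm \<Rightarrow> 'y str \<Rightarrow> 'y str \<Rightarrow> bool" where
  "rewrites_to e s s' \<longleftrightarrow> left (trm_of_str s) * right (trm_of_str s') \<le> e"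


section \<open>Two-counter machines\<close>

datatype counter = Counter1 | Counter2

datatype 'q instr = Inc counter 'q | IfZ counter 'q 'q | Halt bit

text \<open>The finite set of states is the universe of a type \<open>'q::finite\<close>.\<close>

datatype 'q machine = Machine (init: 'q) (instr_at: "'q \<Rightarrow> 'q instr")

datatype 'q symb = State 'q | SymA | SymB | SymC bit

instantiation symb :: (type) commutable
begin

definition commutes_symb :: "'a symb \<Rightarrow> 'a symb \<Rightarrow> bool" where
  "commutes_symb x y \<longleftrightarrow> x = y"

instance by standard (simp_all add: commutes_symb_def)

end

instance bit :: finite
proof
  have "(UNIV :: bit set) = {0, 1}"
    by (metis (full_types) UNIV_eq_I bit.exhaust insertI1 insertI2)
  then show "finite (UNIV :: bit set)" by (metis finite.emptyI finite.insertI)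
qed

instance symb :: (finite) finite
proof
  have "x \<in> range State \<union> {SymA, SymB} \<union> range SymC" for x :: "'a symb"
    by (cases x) simp_all
  then have "(UNIV :: 'a symb set) = range State \<union> {SymA, SymB} \<union> range SymC"
    by (intro UNIV_eq_I)
  then show "finite (UNIV :: 'a symb set)"
    by (rule ssubst) (intro finite_UnI finite_imageI finite_insert[THEN iffD2] finite.emptyI finite)
qed

definition config_trm :: "'q::finite symb trm" where
  "config_trm = (var SymA)\<^sup>\<star> * (var SymB)\<^sup>\<star> * (\<Sum>q\<in>UNIV. var (State q))"

definition T_trm :: "'q::finite symb trm" where
  "T_trm = config_trm + var (SymC 0) + var (SymC 1)"

abbreviation a_l :: "'q symb dbl trm" where "a_l \<equiv> var (L SymA)"
abbreviation a_r :: "'q symb dbl trm" where "a_r \<equiv> var (R SymA)"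
abbreviation b_l :: "'q symb dbl trm" where "b_l \<equiv> var (L SymB)"
abbreviation b_r :: "'q symb dbl trm" where "b_r \<equiv> var (R SymB)"
abbreviation q_l :: "'q \<Rightarrow> 'q symb dbl trm" where "q_l q \<equiv> var (L (State q))"
abbreviation q_r :: "'q \<Rightarrow> 'q symb dbl trm" where "q_r q \<equiv> var (R (State q))"

fun instr_trm :: "'q instr \<Rightarrow> 'q symb dbl trm" where
  "instr_trm (Inc Counter1 q) = a_r * (a_l * a_r)\<^sup>\<star> * (b_l * b_r)\<^sup>\<star> * q_r q"
| "instr_trm (Inc Counter2 q) = (a_l * a_r)\<^sup>\<star> * b_r * (b_l * b_r)\<^sup>\<star> * q_r q"
| "instr_trm (IfZ Counter1 q1 q2) =
     (b_l * b_r)\<^sup>\<star> * q_r q1 + a_l * (a_l * a_r)\<^sup>\<star> * (b_l * b_r)\<^sup>\<star> * q_r q2"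
| "instr_trm (IfZ Counter2 q1 q2) =
     (a_l * a_r)\<^sup>\<star> * q_r q1 + (a_l * a_r)\<^sup>\<star> * b_l * (b_l * b_r)\<^sup>\<star> * q_r q2"
| "instr_trm (Halt x) = var (R (SymC x))"

definition R_trm :: "'q::finite machine \<Rightarrow> 'q symb dbl trm" where
  "R_trm M = (\<Sum>q\<in>UNIV. instr_trm (instr_at M q) * q_l q)"

definition diag_star :: "'q::finite symb dbl trm" where
  "diag_star = (\<Sum>x\<in>UNIV. var (L x) * var (R x))\<^sup>\<star>"

definition all_star :: "'q::finite symb dbl trm" where
  "all_star = (\<Sum>y\<in>UNIV. var y)\<^sup>\<star>"

definition neq_trm :: "'q::finite symb dbl trm" where
  "neq_trm = (\<Sum>(x, y) \<in> {(x, y). x \<noteq> y}. var (L x) * var (R y))"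

end

theory Submission
  imports Defs
begin

text \<open>A string over the doubled alphabet is tracked through its left and right projections.
  A run \<open>s = s\<^sub>0 \<rightarrow> \<dots> \<rightarrow> s\<^sub>n = c\<^sub>x\<close> yields in the language of \<open>s\<^sub>r R\<^sup>*\<close> the string with left
  projection \<open>s\<^sub>0 \<dots> s\<^sub>n\<^sub>-\<^sub>1\<close> and right projection \<open>s\<^sub>0 \<dots> s\<^sub>n\<^sub>-\<^sub>1 c\<^sub>x\<close>. As the former is a prefix of the
  latter, no position shows a mismatch, so the second summand of the upper bound is impossible;
  the first one forces the right projection to end in a state or in \<open>c\<^sub>1\<close>.\<close>

text \<open>Languages unwrapped to plain sets of strings, so that the inclusion hypothesis can be
  used elementwise.\<close>

definition words :: "'y::commutable trm \<Rightarrow> 'y str set" where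
  "words e = Rep_lang (lang_of e)"

lemma lang_of_morphism: "pka_morphism lang_of"
  unfolding lang_of_def by (rule ext_morphism[OF respects_comm_lang_letter])

lemma lang_of_var: "lang_of (var y) = lang_letter y"
  unfolding lang_of_def by (rule ext_var[OF respects_comm_lang_letter])

lemma words_simps:
  "words 0 = {}"
  "words 1 = {1}"
  "words (e + f) = words e \<union> words f"
  "words (e * f) = conc (words e) (words f)"
  "words (e\<^sup>\<star>) = lstar (words e)"
  "words (var y) = {letter y}"
  by (simp_all add: words_def lang_of_morphism[unfolded pka_morphism_def] zero_lang.rep_eq one_lang.rep_eq
      plus_lang.rep_eq times_lang.rep_eq star_lang.rep_eq lang_of_var lang_letter.rep_eq)

lemma words_sum: "finite A \<Longrightarrow> words (\<Sum>i\<in>A. f i) = (\<Union>i\<in>A. words (f i))"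
  by (induction A rule: finite_induct) (simp_all add: words_simps)

lemma words_trm_of_str: "words (trm_of_str u) = {u}"
proof (induction u)
  case (1 w)
  show ?case
  proof (induction w)
    case Nil
    show ?case
      using words_simps(2) trm_of_str_simps(1) by (metis one_str_def)
  next
    case (Cons y w)
    have "abs_str (y # w) = letter y * abs_str w"
      by (simp add: letter_def times_str.abs_eq)
    then show ?case
      using Cons by (simp add: trm_of_str_simps words_simps conc_def)
  qed
qed

lemma words_mono: "e \<le> f \<Longrightarrow> words e \<subseteq> words f"
  by (metis less_eq_iff_add words_simps(3) sup.absorb_iff2)

text \<open>Soundness of the order on terms for languages: it turns a rewriting step, defined by
  derivability, into membership.\<close>

lemma in_words_if_le: "trm_of_str u \<le> e \<Longrightarrow> u \<in> words e"
  using words_mono words_trm_of_str by blast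

text \<open>\<open>lpow\<close> adds factors on the left, whereas a run grows on the right.\<close>

lemma lstar_snoc:
  assumes "u \<in> lstar A" "v \<in> A"
  shows "u * v \<in> lstar A"
proof -
  have "u \<in> lpow A n \<Longrightarrow> u * v \<in> lpow A (Suc n)" for n
  proof (induction n arbitrary: u)
    case 0
    then show ?case using assms(2) by (simp add: conc_def)
  next
    case (Suc n)
    then obtain a w where "u = a * w" "a \<in> A" "w \<in> lpow A n"
      by (auto simp: conc_def)
    with Suc.IH[of w] show ?case
      \<comment> \<open>A single unfolding leaves \<open>lpow A (Suc n)\<close> intact, as the
        induction hypothesis needs it.\<close>
      by (subst lpow.simps) (auto simp: conc_def mult.assoc simp del: lpow.simps)
  qed
  then show ?thesis using assms(1) unfolding lstar_def by blast
qed

lemma lstar_closed_induct [consumes 1, case_names one mult]: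
  assumes "u \<in> lstar A" and "P 1" and "\<And>a v. a \<in> A \<Longrightarrow> P v \<Longrightarrow> P (a * v)"
  shows "P u"
proof -
  have "u \<in> lpow A n \<Longrightarrow> P u" for n
    by (induction n arbitrary: u) (auto simp: conc_def assms(2,3))
  then show ?thesis using assms(1) by (auto simp: lstar_def)
qed

primrec left_letter :: "'y dbl \<Rightarrow> 'y list" where
  "left_letter (L y) = [y]"
| "left_letter (R y) = []"

primrec right_letter :: "'y dbl \<Rightarrow> 'y list" where
  "right_letter (L y) = []"
| "right_letter (R y) = [y]"

text \<open>Erases the right letters. Swapping a left and a right letter becomes invisible, and
  swapping two left letters remains a legal swap.\<close>

lift_definition left_proj :: "'y::commutable dbl str \<Rightarrow> 'y str" is "\<lambda>w. concat (map left_letter w)"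
  subgoal for u v
  proof (induction u v rule: str_eq.induct)
    case (str_eq_swap x y)
    then show ?case by (cases x; cases y) (auto intro: str_eq.intros)
  qed (auto intro: str_eq.intros)
  done

lift_definition right_proj :: "'y::commutable dbl str \<Rightarrow> 'y str" is "\<lambda>w. concat (map right_letter w)"
  subgoal for u v
  proof (induction u v rule: str_eq.induct)
    case (str_eq_swap x y)
    then show ?case by (cases x; cases y) (auto intro: str_eq.intros)
  qed (auto intro: str_eq.intros)
  done

lemma proj_mult:
  "left_proj (u * v) = left_proj u * left_proj v"
  "right_proj (u * v) = right_proj u * right_proj v"
  by (induction u; induction v; simp add: times_str.abs_eq left_proj.abs_eq right_proj.abs_eq)+

lemma proj_one: "left_proj 1 = 1" "right_proj 1 = 1"
  by (simp_all add: one_str_def left_proj.abs_eq right_proj.abs_eq)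

lemma proj_letter:
  "left_proj (letter (L y)) = letter y" "left_proj (letter (R y)) = 1"
  "right_proj (letter (L y)) = 1" "right_proj (letter (R y)) = letter y"
  by (simp_all add: letter_def one_str_def left_proj.abs_eq right_proj.abs_eq)

lift_definition left_str :: "'y::commutable str \<Rightarrow> 'y dbl str" is "map L"
  subgoal for u v
    by (induction u v rule: str_eq.induct) (auto intro: str_eq.intros)
  done

lift_definition right_str :: "'y::commutable str \<Rightarrow> 'y dbl str" is "map R"
  subgoal for u v
    by (induction u v rule: str_eq.induct) (auto intro: str_eq.intros)
  done

text \<open>Stated with compositions because simplification fuses nested maps into this
  form.\<close>

lemma concat_map_proj:
  "concat (map (left_letter \<circ> L) w) = w" "concat (map (left_letter \<circ> R) w) = []"
  "concat (map (right_letter \<circ> L) w) = []" "concat (map (right_letter \<circ> R) w) = w"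
  by (induction w) simp_all

lemma proj_embed:
  "left_proj (left_str s) = s" "left_proj (right_str s) = 1"
  "right_proj (left_str s) = 1" "right_proj (right_str s) = s"
  by (induction s; simp add: left_str.abs_eq right_str.abs_eq left_proj.abs_eq right_proj.abs_eq
      one_str_def concat_map_proj)+

lemma left_simps:
  "left 1 = 1"
  "left (e * f) = left e * left f"
  "left (var y) = var (L y)"
  by (simp_all add: left_def ext_morphism[OF respects_comm_var_dbl(1), unfolded pka_morphism_def]
      ext_var[OF respects_comm_var_dbl(1)])

lemma right_simps:
  "right 0 = 0"
  "right 1 = 1"
  "right (e + f) = right e + right f"
  "right (e * f) = right e * right f"
  "right (var y) = var (R y)"
  by (simp_all add: right_def ext_morphism[OF respects_comm_var_dbl(2), unfolded pka_morphism_def]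
      ext_var[OF respects_comm_var_dbl(2)])

lemma left_trm_of_str: "left (trm_of_str s) = trm_of_str (left_str s)"
proof (induction s)
  case (1 w)
  have "left (prod_list (map var w)) = prod_list (map var (map L w))"
    by (induction w) (simp_all add: left_simps)
  then show ?case by (simp add: trm_of_str.abs_eq left_str.abs_eq)
qed

lemma right_trm_of_str: "right (trm_of_str s) = trm_of_str (right_str s)"
proof (induction s)
  case (1 w)
  have "right (prod_list (map var w)) = prod_list (map var (map R w))"
    by (induction w) (simp_all add: right_simps)
  then show ?case by (simp add: trm_of_str.abs_eq right_str.abs_eq)
qed

lemma right_sum: "finite A \<Longrightarrow> right (\<Sum>i\<in>A. f i) = (\<Sum>i\<in>A. right (f i))"
  by (induction A rule: finite_induct) (simp_all add: right_simps)

text \<open>Induction along the run: the left projection always lags behind the right one by exactly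
  the current configuration.\<close>

lemma rewrites_imp_word:
  assumes "(rewrites_to e)\<^sup>*\<^sup>* s t"
  shows "\<exists>u \<in> words (right (trm_of_str s) * e\<^sup>\<star>). right_proj u = left_proj u * t"
  using assms
proof (induction rule: rtranclp_induct)
  case base
  have "1 \<in> lstar (words e)"
    using lstar_unfold by blast
  then have "right_str s \<in> words (right (trm_of_str s) * e\<^sup>\<star>)"
    by (force simp: words_simps right_trm_of_str words_trm_of_str conc_def)
  then show ?case
    by (intro bexI[where x = "right_str s"]) (simp_all add: proj_embed)
next
  case (step t t')
  then obtain u v where uv: "u = right_str s * v" "v \<in> lstar (words e)"
    and u: "right_proj u = left_proj u * t"
    by (auto simp: words_simps right_trm_of_str words_trm_of_str conc_def)
  \<comment> \<open>The block of the new step: its left half catches up with the pending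
    \<open>t\<close>, and its right half makes \<open>t'\<close> pending.\<close>
  let ?r = "left_str t * right_str t'"
  have "?r \<in> words e"
    using step.hyps(2)
    by (intro in_words_if_le)
      (simp add: rewrites_to_def trm_of_str_simps left_trm_of_str right_trm_of_str)
  then have "v * ?r \<in> lstar (words e)"
    using uv(2) by (rule lstar_snoc[rotated])
  then have "u * ?r \<in> words (right (trm_of_str s) * e\<^sup>\<star>)"
    by (auto simp: uv(1) words_simps right_trm_of_str words_trm_of_str conc_def mult.assoc)
  moreover have "right_proj (u * ?r) = left_proj (u * ?r) * t'"
    by (simp add: proj_mult proj_embed u mult.assoc)
  ultimately show ?case by blast
qed

text \<open>Well defined because the alphabet is discrete, so that a swap is trivial.\<close>

lift_definition symbs :: "'q symb str \<Rightarrow> 'q symb list" is "\<lambda>w. w"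
  subgoal for u v
    by (induction u v rule: str_eq.induct) (simp_all add: commutes_symb_def)
  done

lemma symbs_mult: "symbs (u * v) = symbs u @ symbs v"
  by (induction u; induction v) (simp add: times_str.abs_eq symbs.abs_eq)

lemma symbs_letter: "symbs (letter y) = [y]"
  by (simp add: letter_def symbs.abs_eq)

lemma diag_star_proj:
  assumes "u \<in> words diag_star"
  shows "left_proj u = right_proj u"
  using assms unfolding diag_star_def words_simps
  by (induction rule: lstar_closed_induct)
    (auto simp: words_sum words_simps conc_def proj_one proj_mult proj_letter)

text \<open>Every word of \<open>config_trm\<close> ends in a state, and the diagonal prefix does
  not affect the last symbol.\<close>

lemma final_right_proj:
  assumes "u \<in> words (diag_star * right (config_trm + var (SymC 1)))"
  obtains p z where "symbs (right_proj u) = p @ [z]" and "z = SymC 1 \<or> z \<in> range State"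
proof -
  obtain d v where u: "u = d * v"
    and v: "v \<in> words (right (config_trm + var (SymC 1)))"
    using assms by (auto simp: words_simps conc_def)
  consider "v = letter (R (SymC 1))" | w q where "v = w * letter (R (State q))"
    using v by (auto simp: config_trm_def right_simps right_sum words_simps words_sum conc_def)
  then show thesis
    by cases (use that in \<open>auto simp: u proj_mult proj_letter symbs_mult symbs_letter\<close>)
qed

text \<open>The diagonal prefix has equal projections, so the distinct letters \<open>y\<close> and
  \<open>z\<close> land at the same position.\<close>

lemma mismatch_proj:
  assumes "u \<in> words (diag_star * neq_trm * all_star)"
  obtains p y z ps qs where "y \<noteq> z" and "symbs (left_proj u) = p @ y # ps"
    and "symbs (right_proj u) = p @ z # qs"
proof -
  obtain d y z v where "u = d * (letter (L y) * letter (R z)) * v"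
    and "d \<in> words diag_star" and "y \<noteq> z"
    using assms by (auto simp: neq_trm_def words_simps words_sum conc_def)
  then show thesis
    using that by (simp add: proj_mult proj_letter symbs_mult symbs_letter diag_star_proj)
qed

theorem mainTheorem2:
  fixes M :: "'q::finite machine" and s :: "'q symb str" and x :: bit
  assumes "trm_of_str s \<le> T_trm"
    and "lang_of (right (trm_of_str s) * (R_trm M)\<^sup>\<star>)
       \<le> lang_of (diag_star * right (config_trm + var (SymC 1)) + diag_star * neq_trm * all_star)"
    and "(rewrites_to (R_trm M))\<^sup>*\<^sup>* s (letter (SymC x))"
  shows "x = 1"
proof -
  obtain u where "u \<in> words (right (trm_of_str s) * (R_trm M)\<^sup>\<star>)"
    and "right_proj u = left_proj u * letter (SymC x)"
    using rewrites_imp_word[OF assms(3)] by blast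
  then have run: "symbs (right_proj u) = symbs (left_proj u) @ [SymC x]"
    and "u \<in> words (diag_star * right (config_trm + var (SymC 1)) + diag_star * neq_trm * all_star)"
    using assms(2) by (auto simp: symbs_mult symbs_letter words_def less_eq_lang.rep_eq)
  then consider "u \<in> words (diag_star * right (config_trm + var (SymC 1)))"
    | "u \<in> words (diag_star * neq_trm * all_star)"
    by (auto simp: words_simps(3))
  then show ?thesis
  proof cases
    \<comment> \<open>The last symbol of the right projection is \<open>SymC x\<close>, which is not
      a state and hence must be \<open>SymC 1\<close>.\<close>
    case 1
    then show ?thesis
      by (rule final_right_proj) (use run in auto)
  next
    \<comment> \<open>By \<open>run\<close> the left projection is a prefix of the right one, so
      both agree right after \<open>p\<close>, contradicting \<open>y \<noteq> z\<close>.\<close>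
    case 2
    then show ?thesis
      by (rule mismatch_proj) (use run in auto)
  qed
qed

end
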